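(* Let $A,E\in\mathbb{R}^{n\times n}$ with $E$ non-singular, and assume that every eigenvalue of $E^{-1}A$ has strictly negative real part. Let $M\in\mathbb{R}^{n\times n}$ be the (unique) solution of the generalised Lyapunov equation $$A^{\top} M E + E^{\top} M A + I_n = 0,$$ where $I_n$ is the identity matrix, and let $\widetilde{M}\in\mathbb{R}^{n\times n}$ be any symmetric matrix. If $$\|\widetilde{M}-M\| < \frac{1}{\|A^{\top}\|\cdot\|E\| + \|A\|\cdot\|E^{\top}\|}$$ in some subordinate matrix norm $\|\cdot\|$, then $\widetilde{M}$ is positive definite and satisfies the Lyapunov inequality $$A^{\top}\widetilde{M}E + E^{\top}\widetilde{M}A < 0,$$ i.e., the left-hand side is negative definite.
   Context: A subordinate matrix norm is an operator norm on $n\times n$ matrices induced by a vector norm. The linear system of ordinary differential equations $E\dot{x}(t)=Ax(t)+Bu(t)$ with non-singular $E$ is called asymptotically stable if all eigenvalues of $E^{-1}A$ have strictly negative real part; in that case the generalised Lyapunov equation $A^{\top}ME+E^{\top}MA+F=0$ has, for every symmetric positive definite $F$, a unique solution $M$, which is symmetric positive definite. *)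

theory Defs
  imports "HOL-Analysis.Analysis"
begin

definition vector_norm :: "(real ^ 'n \<Rightarrow> real) \<Rightarrow> bool" where
  "vector_norm N \<longleftrightarrow>
     (\<forall>x. 0 \<le> N x) \<and>
     (\<forall>x. N x = 0 \<longleftrightarrow> x = 0) \<and>
     (\<forall>c x. N (c *\<^sub>R x) = \<bar>c\<bar> * N x) \<and>
     (\<forall>x y. N (x + y) \<le> N x + N y)"

(* The supremum is over a nonempty set, which is bounded above whenever N is a norm,
   since all norms on a finite-dimensional space are equivalent. *)
definition subordinate_norm :: "(real ^ 'n \<Rightarrow> real) \<Rightarrow> real ^ 'n ^ 'n \<Rightarrow> real" where
  "subordinate_norm N A = (SUP x\<in>{x. x \<noteq> 0}. N (A *v x) / N x)"

(* Eigenvalues of a real matrix are taken over the complex numbers. *)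
definition eigenvalue :: "real ^ 'n ^ 'n \<Rightarrow> complex \<Rightarrow> bool" where
  "eigenvalue A c \<longleftrightarrow> (\<exists>v. v \<noteq> 0 \<and> map_matrix complex_of_real A *v v = c *s v)"

definition symmetric_matrix :: "'a ^ 'n ^ 'n \<Rightarrow> bool" where
  "symmetric_matrix A \<longleftrightarrow> transpose A = A"

(* Definiteness includes symmetry. *)
definition positive_definite :: "real ^ 'n ^ 'n \<Rightarrow> bool" where
  "positive_definite A \<longleftrightarrow> symmetric_matrix A \<and> (\<forall>x. x \<noteq> 0 \<longrightarrow> 0 < x \<bullet> (A *v x))"

definition negative_definite :: "real ^ 'n ^ 'n \<Rightarrow> bool" where
  "negative_definite A \<longleftrightarrow> symmetric_matrix A \<and> (\<forall>x. x \<noteq> 0 \<longrightarrow> x \<bullet> (A *v x) < 0)"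

end

theory Submission
  imports Defs "HOL-Computational_Algebra.Fundamental_Theorem_Algebra"
begin

text \<open>
  Put \<open>W = A\<^sup>T Mt E + E\<^sup>T Mt A\<close> and \<open>G = W + I\<close>. By the equation for \<open>M\<close>, the matrix \<open>G\<close> is
  \<open>A\<^sup>T (Mt - M) E + E\<^sup>T (Mt - M) A\<close>, so the assumption gives \<open>N (G x) < N x\<close> for \<open>x \<noteq> 0\<close>; hence the
  largest eigenvalue of the symmetric matrix \<open>G\<close> is below 1 and \<open>W\<close> is negative definite.
  With \<open>B = E\<^sup>-\<^sup>1 A\<close> and \<open>S = E\<^sup>T Mt E\<close> this says that the quadratic form of \<open>S\<close> decreases along the
  Cayley iteration \<open>(I - B) x\<^sub>k\<^sub>+\<^sub>1 = (I + B) x\<^sub>k\<close>. The iteration tends to 0 because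
  \<open>\<bar>(1 + l) / (1 - l)\<bar> < 1\<close> for every eigenvalue \<open>l\<close> of \<open>B\<close>, so the form is positive at every \<open>x\<^sub>0 \<noteq> 0\<close>.
\<close>

section \<open>Equivalence of norms and the finiteness of induced matrix norms\<close>

lemma norm_le_const_mult_norm:
  fixes N :: "real ^ 'n \<Rightarrow> real"
  assumes "vector_norm N"
  obtains C where "0 < C" "\<And>x. N x \<le> C * norm x"
proof
  have scale: "N (c *\<^sub>R x) = \<bar>c\<bar> * N x" and tri: "N (x + y) \<le> N x + N y" and nn: "0 \<le> N x" for c x y
    using assms by (auto simp: vector_norm_def)
  have N0: "N 0 = 0"
    using assms by (auto simp: vector_norm_def)
  have sum_le: "N (\<Sum>i\<in>I. f i) \<le> (\<Sum>i\<in>I. N (f i))" if "finite I" for f and I :: "'n set"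
    using that
  proof (induction I)
    case (insert i I)
    then show ?case using tri[of "f i" "sum f I"] by simp
  qed (simp add: N0)
  \<comment> \<open>Expanding \<open>x\<close> in the standard basis bounds \<open>N x\<close> by
    the sum of the \<open>N (axis i 1)\<close> times \<open>norm x\<close>; the added 1 makes the
    constant positive.\<close>
  let ?C = "1 + (\<Sum>i\<in>UNIV. N (axis i 1))"
  have sum_nn: "0 \<le> (\<Sum>i\<in>UNIV. N (axis i 1))"
    by (simp add: nn sum_nonneg)
  show "0 < ?C" using sum_nn by simp
  show "N x \<le> ?C * norm x" for x
  proof -
    have "x = (\<Sum>i\<in>UNIV. (x $ i) *\<^sub>R axis i 1)"
      using basis_expansion[of x] by (simp add: scalar_mult_eq_scaleR)
    then have "N x \<le> (\<Sum>i\<in>UNIV. N ((x $ i) *\<^sub>R axis i 1))"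
      using sum_le[of UNIV "\<lambda>i. (x $ i) *\<^sub>R axis i 1"] by simp
    also have "\<dots> \<le> (\<Sum>i\<in>UNIV. norm x * N (axis i 1))"
      by (intro sum_mono) (simp add: scale mult_right_mono component_le_norm_cart nn)
    also have "\<dots> \<le> ?C * norm x"
      by (simp add: sum_distrib_left algebra_simps)
    finally show ?thesis .
  qed
qed

text \<open>The upper bound makes \<open>N\<close> Lipschitz for the Euclidean norm, so
  \<open>N\<close> attains its minimum on the compact unit sphere. Definiteness makes this minimum
  positive, and homogeneity extends the bound to all vectors.\<close>

lemma const_mult_norm_le:
  fixes N :: "real ^ 'n \<Rightarrow> real"
  assumes N: "vector_norm N"
  obtains c where "0 < c" "\<And>x. c * norm x \<le> N x"
proof -
  have scale: "N (c *\<^sub>R x) = \<bar>c\<bar> * N x" and tri: "N (x + y) \<le> N x + N y"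
    and nn: "0 \<le> N x" and zero: "N x = 0 \<longleftrightarrow> x = 0" for c x y
    using N by (auto simp: vector_norm_def)
  obtain C where C: "0 < C" "\<And>x. N x \<le> C * norm x"
    using norm_le_const_mult_norm[OF N] by metis
  have "\<bar>N x - N y\<bar> \<le> C * norm (x - y)" for x y
    using tri[of "x - y" y] tri[of "y - x" x] C(2)[of "x - y"] C(2)[of "y - x"]
    by (simp add: norm_minus_commute abs_le_iff)
  then have "C-lipschitz_on UNIV N"
    using C(1) by (auto simp: lipschitz_on_def dist_real_def dist_norm)
  then have "continuous_on (sphere 0 1) N"
    using lipschitz_on_continuous_on continuous_on_subset by blast
  moreover have "sphere (0 :: real ^ 'n) 1 \<noteq> {}"
    by simp
  ultimately obtain u where u: "u \<in> sphere 0 1" "\<And>x. x \<in> sphere 0 1 \<Longrightarrow> N u \<le> N x"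
    using continuous_attains_inf[of "sphere (0 :: real ^ 'n) 1" N] compact_sphere by blast
  have "0 < N u"
    using u(1) nn[of u] zero[of u] by (cases "u = 0") auto
  moreover have "N u * norm x \<le> N x" for x
  proof (cases "x = 0")
    case False
    have "N u \<le> N ((1 / norm x) *\<^sub>R x)"
      using False by (intro u(2)) simp
    then show ?thesis
      using False by (simp add: scale field_simps)
  qed (simp add: nn)
  ultimately show ?thesis using that by blast
qed

text \<open>On the reals \<open>SUP\<close> is an upper bound only for sets bounded above, so this
  is what gives \<open>subordinate_norm\<close> its meaning. Both equivalence constants enter, one
  for the numerator and one for the denominator.\<close>

lemma bdd_above_subordinate_norm:
  fixes A :: "real ^ 'n ^ 'n"
  assumes N: "vector_norm N"
  shows "bdd_above ((\<lambda>x. N (A *v x) / N x) ` {x. x \<noteq> 0})"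
proof -
  obtain C where C: "0 < C" "\<And>x. N x \<le> C * norm x"
    using norm_le_const_mult_norm[OF N] by metis
  obtain c where c: "0 < c" "\<And>x. c * norm x \<le> N x"
    using const_mult_norm_le[OF N] by metis
  obtain K where K: "\<And>x. norm (A *v x) \<le> norm x * K"
    using bounded_linear.bounded[OF matrix_vector_mul_bounded_linear[of A]] by blast
  have "N (A *v x) / N x \<le> C * K / c" if "x \<noteq> 0" for x
  proof -
    have "0 < c * norm x" using c(1) that by simp
    have "0 \<le> norm x * K"
      using K[of x] norm_ge_zero[of "A *v x"] by linarith
    have "N (A *v x) \<le> C * (norm x * K)"
      using C(2)[of "A *v x"] K[of x] C(1) by (meson mult_left_mono less_imp_le order_trans)
    then have "N (A *v x) / N x \<le> C * (norm x * K) / (c * norm x)"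
      using \<open>0 < c * norm x\<close> \<open>0 \<le> norm x * K\<close> c(2)[of x] C(1) by (intro frac_le) auto
    then show ?thesis using that by simp
  qed
  then show ?thesis by (intro bdd_aboveI2) auto
qed

lemma subordinate_norm_bound:
  fixes A :: "real ^ 'n ^ 'n"
  assumes N: "vector_norm N"
  shows "N (A *v x) \<le> subordinate_norm N A * N x"
proof (cases "x = 0")
  case False
  then have "0 < N x"
    using N by (metis vector_norm_def order_le_less)
  have "N (A *v x) / N x \<le> subordinate_norm N A"
    unfolding subordinate_norm_def
    using False bdd_above_subordinate_norm[OF N] by (intro cSUP_upper) auto
  then show ?thesis using \<open>0 < N x\<close> by (simp add: field_simps)
next
  case True
  moreover have "N 0 = 0"
    using N by (simp add: vector_norm_def)
  ultimately show ?thesis by simp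
qed

lemma subordinate_norm_nonneg:
  fixes A :: "real ^ 'n ^ 'n"
  assumes N: "vector_norm N"
  shows "0 \<le> subordinate_norm N A"
proof -
  obtain x :: "real ^ 'n" where "x \<noteq> 0"
    using axis_eq_0_iff[of undefined "1 :: real"] by (metis zero_neq_one)
  then have "0 < N x"
    using N by (metis vector_norm_def order_le_less)
  moreover have "0 \<le> subordinate_norm N A * N x"
    using subordinate_norm_bound[OF N, of A x] N
    by (meson vector_norm_def order_trans)
  ultimately show ?thesis
    by (simp add: zero_le_mult_iff)
qed

section \<open>Symmetric matrices and their largest eigenvalue\<close>

lemma transpose_add: "transpose (X + Y) = transpose X + transpose Y"
  by (simp add: transpose_def vec_eq_iff)

lemma matrix_diff_ldistrib: "X ** (Y - Z) = X ** Y - X ** (Z :: 'a::ring_1 ^ 'n ^ 'm)"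
  by (simp add: matrix_matrix_mult_def vec_eq_iff right_diff_distrib sum_subtractf)

lemma matrix_diff_rdistrib: "(X - Y) ** Z = X ** Z - Y ** (Z :: 'a::ring_1 ^ 'n ^ 'm)"
  by (simp add: matrix_matrix_mult_def vec_eq_iff left_diff_distrib sum_subtractf)

lemma symmetric_matrix_inner:
  fixes S :: "real ^ 'n ^ 'n"
  assumes "symmetric_matrix S"
  shows "x \<bullet> (S *v y) = (S *v x) \<bullet> y"
  using assms by (metis dot_lmul_matrix symmetric_matrix_def transpose_matrix_vector)

text \<open>Moving from \<open>u\<close> by \<open>- t *\<^sub>R (P *v u)\<close> changes the form
  by a linear term with slope -2 |Pu|^2 and a term of order t^2. For small positive t this is
  negative unless Pu = 0.\<close>

lemma positive_semidefinite_isotropic_imp_kernel: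
  fixes P :: "real ^ 'n ^ 'n"
  assumes P: "symmetric_matrix P" and psd: "\<And>x. 0 \<le> x \<bullet> (P *v x)" and u: "u \<bullet> (P *v u) = 0"
  shows "P *v u = 0"
proof -
  let ?y = "P *v u"
  let ?a = "?y \<bullet> ?y" and ?b = "?y \<bullet> (P *v ?y)"
  have quad: "0 \<le> - 2 * t * ?a + t\<^sup>2 * ?b" for t
    using psd[of "u - t *\<^sub>R ?y"] u symmetric_matrix_inner[OF P, of u ?y]
    by (simp add: matrix_vector_mult_diff_distrib matrix_vector_mult_scaleR inner_diff
        inner_commute power2_eq_square algebra_simps)
  have "0 \<le> ?b" by (rule psd)
  \<comment> \<open>The minimiser of the quadratic is a/b; using b + 1 avoids division by zero when
    b = 0 and still gives a negative value unless a = 0.\<close>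
  let ?t = "?a / (?b + 1)"
  have "0 \<le> (?b + 1)\<^sup>2 * (- 2 * ?t * ?a + ?t\<^sup>2 * ?b)"
    using quad[of ?t] by simp
  also have "\<dots> = - (?a\<^sup>2 * (?b + 2))"
    using \<open>0 \<le> ?b\<close> by (simp add: field_simps power2_eq_square add_nonneg_eq_0_iff)
  finally have "?a\<^sup>2 * (?b + 2) \<le> 0" by simp
  then have "?a = 0"
    using \<open>0 \<le> ?b\<close> by (simp add: mult_le_0_iff)
  then show ?thesis by simp
qed

text \<open>Rayleigh quotient: let \<open>u\<close> maximise the form on the unit sphere, with value
  \<open>l\<close>. Then \<open>l *\<^sub>R mat 1 - G\<close> is positive semidefinite and its form
  vanishes at \<open>u\<close>, so \<open>u\<close> lies in its kernel.\<close>

lemma symmetric_matrix_max_eigenvector: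
  fixes G :: "real ^ 'n ^ 'n"
  assumes G: "symmetric_matrix G"
  obtains u l where "u \<noteq> 0" "G *v u = l *\<^sub>R u" "\<And>x. x \<bullet> (G *v x) \<le> l * (x \<bullet> x)"
proof -
  have "continuous_on (sphere 0 1) (\<lambda>x. x \<bullet> (G *v x))"
    by (intro continuous_intros linear_continuous_on matrix_vector_mul_bounded_linear)
  moreover have "sphere (0 :: real ^ 'n) 1 \<noteq> {}"
    by simp
  ultimately obtain u where u: "norm u = 1"
    and max: "\<And>x. norm x = 1 \<Longrightarrow> x \<bullet> (G *v x) \<le> u \<bullet> (G *v u)"
    using continuous_attains_sup[of "sphere (0 :: real ^ 'n) 1" "\<lambda>x. x \<bullet> (G *v x)"] compact_sphere
    by (auto simp: dist_norm)
  define l where "l = u \<bullet> (G *v u)"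
  have le: "x \<bullet> (G *v x) \<le> l * (x \<bullet> x)" for x
  proof (cases "x = 0")
    case False
    have "(x /\<^sub>R norm x) \<bullet> (G *v (x /\<^sub>R norm x)) \<le> l"
      unfolding l_def using False by (intro max) simp
    then show ?thesis
      using False
      by (simp add: matrix_vector_mult_scaleR field_simps power2_eq_square
          flip: power2_norm_eq_inner)
  qed simp
  let ?P = "l *\<^sub>R mat 1 - G"
  have Pv: "?P *v x = l *\<^sub>R x - G *v x" for x
    by (simp add: matrix_vector_mult_diff_rdistrib scaleR_matrix_vector_assoc[symmetric])
  have "symmetric_matrix ?P"
    using G by (simp add: symmetric_matrix_def transpose_def vec_eq_iff mat_def)
  moreover have "0 \<le> x \<bullet> (?P *v x)" for x
    using le[of x] by (simp only: Pv) (simp add: inner_diff)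
  moreover have "u \<bullet> (?P *v u) = 0"
    using u by (simp only: Pv) (simp add: inner_diff l_def flip: power2_norm_eq_inner)
  ultimately have "?P *v u = 0"
    by (rule positive_semidefinite_isotropic_imp_kernel)
  then have "G *v u = l *\<^sub>R u" by (simp only: Pv right_minus_eq)
  with le u show ?thesis by (intro that[of u l]) auto
qed

section \<open>Polynomials in a matrix, applied to a vector by Horner's scheme\<close>

definition matrix_poly_apply :: "'a::field poly \<Rightarrow> 'a ^ 'n ^ 'n \<Rightarrow> 'a ^ 'n \<Rightarrow> 'a ^ 'n" where
  "matrix_poly_apply p B v = fold_coeffs (\<lambda>a w. a *s v + B *v w) p 0"

lemma matrix_poly_apply_0 [simp]: "matrix_poly_apply 0 B v = 0"
  by (simp add: matrix_poly_apply_def)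

lemma matrix_poly_apply_pCons [simp]:
  "matrix_poly_apply (pCons a p) B v = a *s v + B *v matrix_poly_apply p B v"
  by (cases "p = 0"; cases "a = 0") (simp_all add: matrix_poly_apply_def)

lemma matrix_poly_apply_add:
  "matrix_poly_apply (p + q) B v = matrix_poly_apply p B v + matrix_poly_apply q B v"
  by (induction p q rule: poly_induct2)
    (simp_all add: matrix_vector_right_distrib vec.scale_left_distrib)

lemma matrix_poly_apply_smult:
  "matrix_poly_apply (smult c p) B v = c *s matrix_poly_apply p B v"
  by (induction p) (simp_all add: vec.scale vec.scale_right_distrib vec.scale_scale)

lemma matrix_poly_apply_sum:
  "matrix_poly_apply (\<Sum>i\<in>I. f i) B v = (\<Sum>i\<in>I. matrix_poly_apply (f i) B v)"
  by (induction I rule: infinite_finite_induct) (simp_all add: matrix_poly_apply_add)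

lemma matrix_poly_apply_vec_add:
  "matrix_poly_apply p B (v + w) = matrix_poly_apply p B v + matrix_poly_apply p B w"
  by (induction p) (simp_all add: matrix_vector_right_distrib vec.scale_right_distrib)

lemma matrix_poly_apply_vec_scale:
  "matrix_poly_apply p B (c *s v) = c *s matrix_poly_apply p B v"
  by (induction p) (simp_all add: vec.scale vec.scale_right_distrib vec.scale_scale mult.commute)

lemma matrix_poly_apply_vec_diff:
  "matrix_poly_apply p B (v - w) = matrix_poly_apply p B v - matrix_poly_apply p B w"
  using matrix_poly_apply_vec_add[of p B "v - w" w] by simp

lemma matrix_poly_apply_commute:
  "matrix_poly_apply p B (B *v v) = B *v matrix_poly_apply p B v"
  by (induction p) (simp_all add: matrix_vector_right_distrib vec.scale)

lemma matrix_poly_apply_linear_factor: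
  "matrix_poly_apply ([:- c, 1:] * q) B v =
    B *v matrix_poly_apply q B v - c *s matrix_poly_apply q B v"
proof -
  have "[:- c, 1:] * q = pCons 0 q + smult (- c) q"
    by simp
  then show ?thesis
    by (simp only: matrix_poly_apply_add matrix_poly_apply_smult matrix_poly_apply_pCons) simp
qed

text \<open>The vectors v, Bv, ..., B^n v are one more than the dimension n, and a linear relation
  among them is a polynomial in B that kills v.\<close>

lemma exists_annihilating_poly:
  fixes B :: "'a::field ^ 'n ^ 'n"
  obtains p where "p \<noteq> 0" "matrix_poly_apply p B v = 0"
proof -
  let ?f = "\<lambda>k. matrix_poly_apply (monom 1 k) B v"
  let ?K = "{..vec.dimension TYPE('a) TYPE('n)}"
  show ?thesis
  proof (cases "inj_on ?f ?K")
    \<comment> \<open>If two of these vectors coincide, the image set is too small for the dimension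
      count, but the difference of the two monomials already annihilates v.\<close>
    case False
    then obtain i j where ij: "i \<noteq> j" "?f i = ?f j"
      by (auto simp: inj_on_def)
    then have "monom 1 i - monom (1 :: 'a) j \<noteq> 0"
      by (metis coeff_monom right_minus_eq zero_neq_one)
    moreover have "matrix_poly_apply (monom 1 i - monom 1 j) B v = 0"
      using ij(2) matrix_poly_apply_add[of "monom 1 i - monom 1 j" "monom 1 j" B v] by simp
    ultimately show ?thesis by (rule that)
  next
    case True
    then have "card (?f ` ?K) = Suc (vec.dimension TYPE('a) TYPE('n))"
      by (simp add: card_image)
    then have "vec.dependent (?f ` ?K)"
      using vec.independent_bound_general[of "?f ` ?K"] vec.dim_subset_UNIV[of "?f ` ?K"] by linarith
    then obtain u k where u: "(\<Sum>w\<in>?f ` ?K. u w *s w) = 0" and k: "k \<in> ?K" "u (?f k) \<noteq> 0"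
      unfolding vec.dependent_finite[OF finite_imageI[OF finite_atMost]] by blast
    let ?p = "\<Sum>k\<in>?K. smult (u (?f k)) (monom 1 k)"
    have "coeff ?p k = u (?f k)"
      using k(1) by (simp add: coeff_sum if_distrib cong: if_cong)
    then have "?p \<noteq> 0" using k(2) by (metis coeff_0)
    moreover have "matrix_poly_apply ?p B v = 0"
      using u by (simp only: matrix_poly_apply_sum matrix_poly_apply_smult sum.reindex[OF True] o_def)
    ultimately show ?thesis by (rule that)
  qed
qed

section \<open>Convergence of the Cayley iteration\<close>

lemma contracting_recurrence_tendsto_zero:
  fixes x e :: "nat \<Rightarrow> complex ^ 'n"
  assumes rec: "\<And>k. x (Suc k) = c *s x k + e k" and c: "cmod c < 1" and e: "e \<longlonglongrightarrow> 0"
  shows "x \<longlonglongrightarrow> 0"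
proof -
  have norm_smult: "norm (c *s v) = cmod c * norm v" for v :: "complex ^ 'n"
    by (simp add: norm_vec_def norm_mult L2_set_right_distrib)
  have step: "norm (x (Suc k)) \<le> cmod c * norm (x k) + norm (e k)" for k
    using norm_triangle_ineq[of "c *s x k" "e k"] by (simp add: rec norm_smult)
  have "\<forall>\<^sub>F k in sequentially. norm (x k) < r" if "0 < r" for r
  proof -
    \<comment> \<open>Chosen so that r/2 is the fixed point of t -> |c| t + d. The excess over r/2
      then shrinks geometrically.\<close>
    let ?d = "(1 - cmod c) * (r / 2)"
    have "0 < ?d" using c that by simp
    then obtain K where K: "\<And>k. K \<le> k \<Longrightarrow> norm (e k) < ?d"
      using LIMSEQ_D[OF e] by (metis diff_zero)
    have bound: "norm (x (K + j)) \<le> cmod c ^ j * norm (x K) + r / 2" for j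
    proof (induction j)
      case (Suc j)
      have "norm (x (K + Suc j)) \<le> cmod c * norm (x (K + j)) + ?d"
        using step[of "K + j"] K[of "K + j"] by simp
      also have "\<dots> \<le> cmod c * (cmod c ^ j * norm (x K) + r / 2) + ?d"
        using mult_left_mono[OF Suc, of "cmod c"] by simp
      also have "\<dots> = cmod c ^ Suc j * norm (x K) + r / 2"
        by (simp add: field_simps)
      finally show ?case .
    qed (use that in simp)
    have "(\<lambda>j. cmod c ^ j * norm (x K)) \<longlonglongrightarrow> 0 * norm (x K)"
      using c by (intro tendsto_intros LIMSEQ_realpow_zero) auto
    then have "\<forall>\<^sub>F j in sequentially. cmod c ^ j * norm (x K) < r / 2"
      using that by (intro order_tendstoD(2)) auto
    then have "\<forall>\<^sub>F j in sequentially. norm (x (j + K)) < r"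
    proof (rule eventually_mono)
      fix j
      assume "cmod c ^ j * norm (x K) < r / 2"
      then show "norm (x (j + K)) < r"
        using bound[of j] by (simp add: add.commute)
    qed
    then show ?thesis
      by (rule eventually_sequentially_seg[THEN iffD1])
  qed
  then show ?thesis
    by (simp add: tendsto_iff dist_norm)
qed

text \<open>The squared moduli of 1 - l and 1 + l differ by -4 Re l: the Cayley map sends the open
  left half-plane into the unit disc.\<close>

lemma norm_cayley_less_1:
  assumes "Re l < 0"
  shows "cmod ((1 + l) / (1 - l)) < 1"
proof -
  have "(cmod (1 + l))\<^sup>2 < (cmod (1 - l))\<^sup>2"
    using assms by (simp only: cmod_power2) (simp add: power2_eq_square algebra_simps)
  then have "cmod (1 + l) < cmod (1 - l)"
    by (rule power2_less_imp_less) simp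
  then show ?thesis
    by (simp add: norm_divide divide_less_eq)
qed

text \<open>Induction on the degree of \<open>p\<close> takes the place of a Jordan form: each step
  splits off one root of \<open>p\<close> and passes to the cofactor \<open>q\<close>.\<close>

lemma annihilated_cayley_iteration_tendsto_zero:
  fixes B :: "complex ^ 'n ^ 'n"
  assumes "\<And>c v. v \<noteq> 0 \<Longrightarrow> B *v v = c *s v \<Longrightarrow> Re c < 0"
    and "p \<noteq> 0"
    and "\<And>k. x (Suc k) - B *v x (Suc k) = x k + B *v x k"
    and "\<And>k. matrix_poly_apply p B (x k) = 0"
  shows "x \<longlonglongrightarrow> 0"
  using assms(2-4)
proof (induction "degree p" arbitrary: p x)
  case 0
  then obtain a where "p = [:a:]" "a \<noteq> 0"
    by (metis degree_eq_zeroE pCons_0_0)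
  then have "x k = 0" for k
    using "0.prems"(3)[of k] by simp
  then have "x = (\<lambda>k. 0)" by blast
  then show ?case by simp
next
  case (Suc n)
  note p = Suc.prems(1) and rec = Suc.prems(2) and ann = Suc.prems(3)
  obtain l where "poly p l = 0"
    using fundamental_theorem_of_algebra[of p] Suc.hyps(2) by (auto simp: constant_degree)
  then obtain q where pq: "p = [:- l, 1:] * q"
    by (auto simp: poly_eq_0_iff_dvd)
  have q: "q \<noteq> 0" using p pq by auto
  have deg: "n = degree q"
    using Suc.hyps(2) q unfolding pq by (subst (asm) degree_mult_eq) auto
  have root: "B *v matrix_poly_apply q B (x k) = l *s matrix_poly_apply q B (x k)" for k
    using ann[of k] unfolding pq matrix_poly_apply_linear_factor by simp
  show ?case
  proof (cases "Re l < 0")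
    case False
    \<comment> \<open>By \<open>root\<close>, a nonzero q(B) x_k would be an eigenvector for
      \<open>l\<close>, against stability. So \<open>q\<close> annihilates the same
      sequence.\<close>
    then have "matrix_poly_apply q B (x k) = 0" for k
      using assms(1) root by blast
    then show ?thesis
      using rec by (intro Suc.hyps(1)[OF deg q, of x])
  next
    case True
    \<comment> \<open>The sequence (B - l) x_k obeys the same recurrence and is annihilated by
      \<open>q\<close>, so it tends to 0 by induction.\<close>
    define y where "y k = B *v x k - l *s x k" for k
    have "y (Suc k) - B *v y (Suc k) = y k + B *v y k" for k
    proof -
      have "y (Suc k) - B *v y (Suc k) =
          B *v (x (Suc k) - B *v x (Suc k)) - l *s (x (Suc k) - B *v x (Suc k))"
        by (simp add: y_def matrix_vector_mult_diff_distrib vec.scale vec.scale_right_diff_distrib)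
      also have "\<dots> = y k + B *v y k"
        unfolding rec
        by (simp add: y_def matrix_vector_mult_diff_distrib matrix_vector_right_distrib vec.scale
            vec.scale_right_distrib)
      finally show ?thesis .
    qed
    moreover have "matrix_poly_apply q B (y k) = 0" for k
      using root[of k]
      by (simp add: y_def matrix_poly_apply_vec_diff matrix_poly_apply_vec_scale
          matrix_poly_apply_commute)
    ultimately have y: "y \<longlonglongrightarrow> 0"
      using Suc.hyps(1)[OF deg q, of y] by blast
    have l1: "1 - l \<noteq> 0" using True by auto
    let ?c = "(1 + l) / (1 - l)"
    let ?e = "\<lambda>k. inverse (1 - l) *s (y k + y (Suc k))"
    have "x (Suc k) = ?c *s x k + ?e k" for k
    proof -
      \<comment> \<open>Substitute B x = y + l x on both sides of the recurrence. This leaves a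
        scalar Cayley step for \<open>x\<close>, perturbed by the vanishing sequence
        \<open>y\<close>.\<close>
      have "(1 - l) *s x (Suc k) = (1 + l) *s x k + (y k + y (Suc k))"
        using rec[of k] by (simp add: y_def vec.scale_left_distrib vec.scale_left_diff_distrib algebra_simps)
      then have "inverse (1 - l) *s ((1 - l) *s x (Suc k)) =
          inverse (1 - l) *s ((1 + l) *s x k + (y k + y (Suc k)))"
        by simp
      then show ?thesis
        using l1
        by (simp only: vec.scale_right_distrib[of _ "_ *s _"] vec.scale_scale)
          (simp add: divide_inverse mult.commute)
    qed
    moreover have "?e \<longlonglongrightarrow> 0"
    proof (rule vec_tendstoI)
      fix i
      have "(\<lambda>k. inverse (1 - l) * (y k $ i + y (Suc k) $ i)) \<longlonglongrightarrow>
          inverse (1 - l) * (0 $ i + 0 $ i)"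
        by (intro tendsto_intros y LIMSEQ_Suc[OF y])
      then show "(\<lambda>k. ?e k $ i) \<longlonglongrightarrow> 0 $ i"
        by (simp add: distrib_left)
    qed
    ultimately show ?thesis
      using norm_cayley_less_1[OF True]
      by (intro contracting_recurrence_tendsto_zero[of x ?c ?e])
  qed
qed

lemma cayley_iteration_tendsto_zero:
  fixes B :: "complex ^ 'n ^ 'n"
  assumes stable: "\<And>c v. v \<noteq> 0 \<Longrightarrow> B *v v = c *s v \<Longrightarrow> Re c < 0"
    and rec: "\<And>k. x (Suc k) - B *v x (Suc k) = x k + B *v x k"
  shows "x \<longlonglongrightarrow> 0"
proof -
  obtain p where p: "p \<noteq> 0" "matrix_poly_apply p B (x 0) = 0"
    by (rule exists_annihilating_poly)
  \<comment> \<open>Since p(B) commutes with B, the recurrence makes w = p(B) x_{k+1} satisfy w = B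
    w. As 1 is not an eigenvalue, w = 0, so the polynomial found for x_0 serves all
    iterates.\<close>
  have "matrix_poly_apply p B (x k) = 0" for k
  proof (induction k)
    case (Suc k)
    have "matrix_poly_apply p B (x (Suc k) - B *v x (Suc k)) = 0"
      unfolding rec by (simp add: matrix_poly_apply_vec_add matrix_poly_apply_commute Suc)
    then have "B *v matrix_poly_apply p B (x (Suc k)) = 1 *s matrix_poly_apply p B (x (Suc k))"
      by (simp add: matrix_poly_apply_vec_diff matrix_poly_apply_commute)
    then show ?case
      using stable[of "matrix_poly_apply p B (x (Suc k))" 1] by fastforce
  qed (rule p)
  with stable p(1) rec show ?thesis
    by (rule annihilated_cayley_iteration_tendsto_zero[where B = B and p = p and x = x])
qed

lemma real_cayley_iteration_tendsto_zero:
  fixes B :: "real ^ 'n ^ 'n"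
  assumes stable: "\<And>c. eigenvalue B c \<Longrightarrow> Re c < 0"
    and rec: "\<And>k. x (Suc k) - B *v x (Suc k) = x k + B *v x k"
  shows "x \<longlonglongrightarrow> 0"
\<comment> \<open>Stability concerns complex eigenvalues, so the iteration is embedded in the
  complex space and real parts are taken at the end.\<close>
proof -
  let ?B = "map_matrix complex_of_real B"
  define z where "z k = (\<chi> i. complex_of_real (x k $ i))" for k
  have Bz: "(?B *v z k) $ i = complex_of_real ((B *v x k) $ i)" for k i
    by (simp add: z_def matrix_vector_mult_def)
  have "z (Suc k) - ?B *v z (Suc k) = z k + ?B *v z k" for k
  proof (subst vec_eq_iff, intro allI)
    fix i
    have "complex_of_real ((x (Suc k) - B *v x (Suc k)) $ i) = complex_of_real ((x k + B *v x k) $ i)"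
      by (simp only: rec)
    then show "(z (Suc k) - ?B *v z (Suc k)) $ i = (z k + ?B *v z k) $ i"
      by (simp add: Bz) (simp add: z_def)
  qed
  then have "z \<longlonglongrightarrow> 0"
    using stable unfolding eigenvalue_def
    by (intro cayley_iteration_tendsto_zero[where B = ?B and x = z]) blast
  show ?thesis
  proof (rule vec_tendstoI)
    fix i
    have "(\<lambda>k. Re (z k $ i)) \<longlonglongrightarrow> Re (0 $ i)"
      by (intro tendsto_intros \<open>z \<longlonglongrightarrow> 0\<close>)
    then show "(\<lambda>k. x k $ i) \<longlonglongrightarrow> 0 $ i" by (simp add: z_def)
  qed
qed

section \<open>Positivity of a quadratic form that decreases along the iteration\<close>

lemma linear_cayley_solvable:
  fixes B :: "real ^ 'n ^ 'n"
  assumes stable: "\<And>c. eigenvalue B c \<Longrightarrow> Re c < 0"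
  shows "\<exists>y. y - B *v y = z"
proof -
  let ?g = "\<lambda>y. y - B *v y"
  have lin: "linear ?g"
    by (intro linear_compose_sub linear_ident matrix_vector_mul_linear)
  \<comment> \<open>A nonzero solution of y = B y would make 1 an eigenvalue. Injectivity in finite
    dimension then gives solvability, which makes the implicit iteration well defined.\<close>
  have "y = 0" if "?g y = 0" for y
  proof (rule ccontr)
    assume "y \<noteq> 0"
    let ?z = "\<chi> i. complex_of_real (y $ i)"
    have "?z \<noteq> 0"
      using \<open>y \<noteq> 0\<close> by (auto simp: vec_eq_iff)
    moreover have "map_matrix complex_of_real B *v ?z = 1 *s ?z"
    proof (simp add: vec_eq_iff, intro allI)
      fix i
      have "y $ i = (B *v y) $ i" using that by simp
      then show "(map_matrix complex_of_real B *v ?z) $ i = complex_of_real (y $ i)"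
        by (simp add: matrix_vector_mult_def)
    qed
    ultimately have "eigenvalue B 1"
      unfolding eigenvalue_def by blast
    with stable show False by fastforce
  qed
  then have "inj ?g"
    using linear_injective_0[OF lin] by blast
  then have "surj ?g"
    using lin linear_injective_imp_surjective by blast
  then show ?thesis by (metis surjD)
qed

text \<open>Discrete form of Lyapunov's argument: \<open>neg\<close> bounds half the derivative of
  the form along x' = Bx. The Cayley iteration is the implicit midpoint rule with step 2, for which
  the decrease of the form is an exact identity.\<close>

lemma lyapunov_positive_definite:
  fixes B S :: "real ^ 'n ^ 'n"
  assumes stable: "\<And>c. eigenvalue B c \<Longrightarrow> Re c < 0"
    and S: "symmetric_matrix S"
    and neg: "\<And>x. x \<noteq> 0 \<Longrightarrow> (B *v x) \<bullet> (S *v x) < 0"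
  shows "positive_definite S"
  unfolding positive_definite_def
proof (intro conjI allI impI S)
  fix v :: "real ^ 'n"
  assume "v \<noteq> 0"
  obtain f where f: "\<And>z. f z - B *v f z = z + B *v z"
  proof -
    have "\<forall>z. \<exists>y. y - B *v y = z + B *v z"
      by (intro allI linear_cayley_solvable stable)
    from choice[OF this] that show ?thesis by blast
  qed
  define x where "x k = (f ^^ k) v" for k
  let ?q = "\<lambda>y. y \<bullet> (S *v y)"
  have rec: "x (Suc k) - B *v x (Suc k) = x k + B *v x k" for k
    by (simp add: x_def f)
  \<comment> \<open>The recurrence says B (x_{k+1} + x_k) = x_{k+1} - x_k, and symmetry of
    \<open>S\<close> turns the difference of the two values into a product of difference and
    sum.\<close>
  have diff: "?q (x (Suc k)) - ?q (x k) =
      (B *v (x (Suc k) + x k)) \<bullet> (S *v (x (Suc k) + x k))" for k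
  proof -
    have "B *v (x (Suc k) + x k) = x (Suc k) - x k"
      using rec[of k] by (simp add: matrix_vector_right_distrib algebra_simps)
    then show ?thesis
      using symmetric_matrix_inner[OF S, of "x k" "x (Suc k)"]
      by (simp only: matrix_vector_right_distrib inner_diff_left inner_add_right)
        (simp add: inner_commute)
  qed
  have decr: "?q (x (Suc k)) \<le> ?q (x k)" for k
    using diff[of k] neg[of "x (Suc k) + x k"] by (cases "x (Suc k) + x k = 0") auto
  \<comment> \<open>The first step must decrease strictly; weak decrease suffices afterwards.
    Together with the limit 0 this yields q(v) > q(x_1) \<ge> 0.\<close>
  have "x 1 + x 0 \<noteq> 0"
  proof
    assume sum: "x 1 + x 0 = 0"
    then have "x 1 = - x 0" by (simp add: eq_neg_iff_add_eq_0)
    moreover from this have "B *v x 1 = - (B *v x 0)"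
      by (simp add: vec.neg)
    ultimately have "- x 0 + B *v x 0 = x 0 + B *v x 0"
      using rec[of 0] by simp
    then have "x 0 = 0"
      by (simp add: vec_eq_iff)
    then show False using \<open>v \<noteq> 0\<close> by (simp add: x_def)
  qed
  then have "?q (x 1) < ?q (x 0)"
    using diff[of 0] neg[of "x 1 + x 0"] by simp
  moreover have "0 \<le> ?q (x 1)"
  proof -
    have "x \<longlonglongrightarrow> 0"
      using stable rec by (rule real_cayley_iteration_tendsto_zero[where B = B and x = x])
    then have "(\<lambda>k. ?q (x k)) \<longlonglongrightarrow> 0 \<bullet> (S *v 0)"
      by (intro tendsto_intros bounded_linear.tendsto[OF matrix_vector_mul_bounded_linear])
    moreover have "decseq (\<lambda>k. ?q (x k))"
      by (intro decseq_SucI decr)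
    ultimately show ?thesis
      using decseq_ge[of "\<lambda>k. ?q (x k)" 0 1] by simp
  qed
  ultimately show "0 < v \<bullet> (S *v v)" by (simp add: x_def)
qed

section \<open>From the norm bound to both definiteness claims\<close>

theorem theorem2:
  fixes A E M Mt :: "real ^ 'n ^ 'n"
    and N :: "real ^ 'n \<Rightarrow> real"
  assumes "invertible E"
    and "\<And>c. eigenvalue (matrix_inv E ** A) c \<Longrightarrow> Re c < 0"
    and "transpose A ** M ** E + transpose E ** M ** A + mat 1 = 0"
    and "symmetric_matrix Mt"
    and "vector_norm N"
    and "subordinate_norm N (Mt - M) <
      1 / (subordinate_norm N (transpose A) * subordinate_norm N E
         + subordinate_norm N A * subordinate_norm N (transpose E))"
  shows "positive_definite Mt \<and>
    negative_definite (transpose A ** Mt ** E + transpose E ** Mt ** A)"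
proof -
  let ?D = "Mt - M"
  define W where "W = transpose A ** Mt ** E + transpose E ** Mt ** A"
  define G where "G = transpose A ** ?D ** E + transpose E ** ?D ** A"
  have Mt: "transpose Mt = Mt"
    using assms(4) by (simp add: symmetric_matrix_def)
  have W: "symmetric_matrix W"
    by (simp add: W_def symmetric_matrix_def transpose_add matrix_transpose_mul Mt
        matrix_mul_assoc add.commute)
  have GW: "G = W + mat 1"
  proof -
    have "G = W - (transpose A ** M ** E + transpose E ** M ** A)"
      by (simp add: G_def W_def matrix_diff_ldistrib matrix_diff_rdistrib)
    also have "transpose A ** M ** E + transpose E ** M ** A = - mat 1"
      using assms(3) by (simp add: eq_neg_iff_add_eq_0)
    finally show ?thesis by simp
  qed
  \<comment> \<open>Symmetry is read off from \<open>W\<close>, which contains \<open>Mt\<close>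
    only; \<open>M\<close> enters through the Lyapunov equation.\<close>
  have G: "symmetric_matrix G"
    using W by (simp add: GW symmetric_matrix_def transpose_add)
  have Gv: "G *v x = W *v x + x" for x
    by (simp add: GW matrix_vector_mult_add_rdistrib)
  obtain u l where u: "u \<noteq> 0" "G *v u = l *\<^sub>R u"
    and max: "\<And>x. x \<bullet> (G *v x) \<le> l * (x \<bullet> x)"
    using symmetric_matrix_max_eigenvector[OF G] by metis
  let ?s = "subordinate_norm N"
  let ?d = "?s (transpose A) * ?s E + ?s A * ?s (transpose E)"
  note bound = subordinate_norm_bound[OF assms(5)] and nonneg = subordinate_norm_nonneg[OF assms(5)]
  have "0 \<le> ?d" by (simp add: nonneg)
  \<comment> \<open>With \<open>?d = 0\<close> the right-hand side of the assumption would be 1 / 0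
    = 0, and a subordinate norm is never below 0.\<close>
  moreover have "?d \<noteq> 0"
    using assms(6) nonneg[of ?D] by auto
  ultimately have d: "?s ?D * ?d < 1"
    using assms(6) by (simp add: field_simps)
  have "0 < N u"
    using u(1) assms(5) by (metis vector_norm_def order_le_less)
  have prod: "N ((X ** Y ** Z) *v u) \<le> ?s X * (?s Y * (?s Z * N u))" for X Y Z
    unfolding matrix_vector_mul_assoc[symmetric]
    by (meson bound nonneg mult_left_mono order_trans)
  \<comment> \<open>The eigenvector links the two norms: any \<open>N\<close> measures |l| through
    \<open>N (G *v u)\<close>, while \<open>l\<close> also bounds the Euclidean form of
    \<open>G\<close>.\<close>
  have "\<bar>l\<bar> * N u = N (G *v u)"
    using assms(5) by (simp add: u(2) vector_norm_def)
  also have "\<dots> \<le> N ((transpose A ** ?D ** E) *v u) + N ((transpose E ** ?D ** A) *v u)"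
    using assms(5) by (simp add: G_def matrix_vector_mult_add_rdistrib vector_norm_def)
  also have "\<dots> \<le> ?s (transpose A) * (?s ?D * (?s E * N u)) + ?s (transpose E) * (?s ?D * (?s A * N u))"
    by (intro add_mono prod)
  also have "\<dots> = ?s ?D * ?d * N u"
    by (simp add: algebra_simps)
  also have "\<dots> < 1 * N u"
    using d \<open>0 < N u\<close> by (intro mult_strict_right_mono)
  finally have "l < 1"
    using \<open>0 < N u\<close> by simp
  have Wneg: "x \<bullet> (W *v x) < 0" if "x \<noteq> 0" for x
  proof -
    have "l * (x \<bullet> x) < x \<bullet> x"
      using \<open>l < 1\<close> that by simp
    then show ?thesis
      using max[of x] by (simp add: Gv inner_add_right)
  qed
  let ?B = "matrix_inv E ** A" and ?S = "transpose E ** Mt ** E"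
  \<comment> \<open>\<open>matrix_inv\<close> is a choice operator; invertibility supplies the
    witness.\<close>
  have E_inv: "E ** matrix_inv E = mat 1"
    using assms(1) someI_ex[of "\<lambda>E'. E ** E' = mat 1 \<and> E' ** E = mat 1"]
    unfolding invertible_def matrix_inv_def by blast
  have EB: "E *v (matrix_inv E *v (A *v x)) = A *v x" for x
    using E_inv by (simp add: matrix_vector_mul_assoc matrix_mul_assoc)
  have tr: "x \<bullet> (transpose X *v y) = (X *v x) \<bullet> y" for x y :: "real ^ 'n" and X
    by (metis dot_lmul_matrix inner_commute transpose_matrix_vector)
  \<comment> \<open>Because EB = A and \<open>Mt\<close> is symmetric, this product is exactly half
    of \<open>x \<bullet> (W *v x)\<close>.\<close>
  have "(?B *v x) \<bullet> (?S *v x) < 0" if "x \<noteq> 0" for x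
  proof -
    have "(?B *v x) \<bullet> (?S *v x) = (A *v x) \<bullet> (Mt *v (E *v x))"
      by (simp only: matrix_vector_mul_assoc[symmetric] tr EB)
    moreover have "x \<bullet> (W *v x) = (A *v x) \<bullet> (Mt *v (E *v x)) + (E *v x) \<bullet> (Mt *v (A *v x))"
      by (simp only: W_def matrix_vector_mult_add_rdistrib inner_add_right
          matrix_vector_mul_assoc[symmetric] tr)
    moreover have "(E *v x) \<bullet> (Mt *v (A *v x)) = (A *v x) \<bullet> (Mt *v (E *v x))"
      using symmetric_matrix_inner[OF assms(4)] by (metis inner_commute)
    ultimately show ?thesis
      using Wneg[OF that] by linarith
  qed
  moreover have "symmetric_matrix ?S"
    by (simp add: symmetric_matrix_def matrix_transpose_mul Mt matrix_mul_assoc)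
  ultimately have S: "positive_definite ?S"
    using assms(2) by (intro lyapunov_positive_definite)
  \<comment> \<open>\<open>?S\<close> is congruent to \<open>Mt\<close> via \<open>E\<close>, so
    positivity at x is that of \<open>?S\<close> at the preimage of x under
    \<open>E\<close>.\<close>
  have "0 < x \<bullet> (Mt *v x)" if "x \<noteq> 0" for x
  proof -
    let ?y = "matrix_inv E *v x"
    have y: "E *v ?y = x"
      using E_inv by (simp add: matrix_vector_mul_assoc)
    then have "?y \<noteq> 0" using that by auto
    then have "0 < ?y \<bullet> (?S *v ?y)"
      using S by (simp add: positive_definite_def)
    also have "\<dots> = x \<bullet> (Mt *v x)"
      by (simp only: matrix_vector_mul_assoc[symmetric] tr y)
    finally show ?thesis .
  qed
  then show ?thesis
    using assms(4) W Wneg unfolding positive_definite_def negative_definite_def W_def by blast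
qed

end
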